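(* Let $K\subseteq\mathbb{R}^n$ be compact, let $\mathcal{A}\subseteq\mathbb{N}^n$ be finite such that $\mathbb{R}[x]_{\mathcal{A}}$ is $K$-full, and let $c,a_1,\ldots,a_m\in\mathbb{R}[x]_{\mathcal{A}}$ be given. Consider the feasibility problem $$\text{(D)}\quad c-\lambda_1a_1-\cdots-\lambda_ma_m\in\mathscr{P}_{\mathcal{A}}(K),\qquad\lambda\in\mathbb{R}^m.$$ (i) Problem (D) is infeasible if there exists $y$ satisfying $$(\ast)\quad \langle c,y\rangle<0,\quad\langle a_i,y\rangle=0\ (i=1,\ldots,m),\quad y\in\mathscr{R}_{\mathcal{A}}(K).$$ (ii) Suppose there does not exist $0\neq a\in\mathrm{span}\{a_1,\ldots,a_m\}$ such that $a\ge0$ on $K$. If (D) is infeasible, then there exists $y$ satisfying $(\ast)$.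
   Context: $\mathbb{N}$ is the set of nonnegative integers; $\mathbb{R}[x]=\mathbb{R}[x_1,\ldots,x_n]$. $\mathbb{R}[x]_{\mathcal{A}}=\mathrm{span}\{x^\alpha:\alpha\in\mathcal{A}\}$; $\mathbb{R}^{\mathcal{A}}$ is the space of real vectors $(y_\alpha)_{\alpha\in\mathcal{A}}$; $\langle p,y\rangle=\sum_{\alpha\in\mathcal{A}} p_\alpha y_\alpha$ for $p=\sum_{\alpha\in\mathcal{A}}p_\alpha x^\alpha$ and $y\in\mathbb{R}^{\mathcal{A}}$. $\mathbb{R}[x]_{\mathcal{A}}$ is $K$-full if some $p\in\mathbb{R}[x]_{\mathcal{A}}$ is positive on $K$. $\mathscr{P}_{\mathcal{A}}(K)=\{p\in\mathbb{R}[x]_{\mathcal{A}}:p(u)\ge0\ \forall u\in K\}$. $\mathscr{R}_{\mathcal{A}}(K)$ is the set of $y\in\mathbb{R}^{\mathcal{A}}$ for which there is a (nonnegative) Borel measure $\mu$ supported in $K$ with $y_\alpha=\int x^\alpha d\mu$ for all $\alpha\in\mathcal{A}$. *)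

theory Defs
  imports "HOL-Analysis.Analysis" "HOL-Library.Poly_Mapping"
begin

text \<open>Polynomials in \<open>n = CARD('n)\<close> variables are finitely supported maps from exponent vectors
  in \<open>nat ^ 'n\<close> to real coefficients.\<close>

type_synonym 'n mpoly = "(nat ^ 'n) \<Rightarrow>\<^sub>0 real"

instantiation poly_mapping :: (type, real_vector) real_vector
begin

lift_definition scaleR_poly_mapping :: "real \<Rightarrow> ('a \<Rightarrow>\<^sub>0 'b) \<Rightarrow> ('a \<Rightarrow>\<^sub>0 'b)"
  is "\<lambda>r f k. r *\<^sub>R f k"
proof -
  fix r :: real and f :: "'a \<Rightarrow> 'b"
  assume "finite {k. f k \<noteq> 0}"
  then show "finite {k. r *\<^sub>R f k \<noteq> 0}"
    by (rule rev_finite_subset) auto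
qed

instance
  by standard (transfer; simp add: fun_eq_iff scaleR_add_right scaleR_add_left)+

end

definition monom_eval :: "nat ^ 'n \<Rightarrow> real ^ 'n \<Rightarrow> real" where
  "monom_eval \<alpha> x = (\<Prod>i\<in>UNIV. (x $ i) ^ (\<alpha> $ i))"

definition poly_eval :: "'n::finite mpoly \<Rightarrow> real ^ 'n \<Rightarrow> real" where
  "poly_eval p x = (\<Sum>\<alpha>\<in>Poly_Mapping.keys p. Poly_Mapping.lookup p \<alpha> * monom_eval \<alpha> x)"

definition poly_space :: "(nat ^ 'n) set \<Rightarrow> 'n::finite mpoly set" where
  "poly_space A = span ((\<lambda>\<alpha>. Poly_Mapping.single \<alpha> 1) ` A)"

definition pairing :: "(nat ^ 'n) set \<Rightarrow> 'n::finite mpoly \<Rightarrow> (nat ^ 'n \<Rightarrow> real) \<Rightarrow> real" where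
  "pairing A p y = (\<Sum>\<alpha>\<in>A. Poly_Mapping.lookup p \<alpha> * y \<alpha>)"

definition K_full :: "(real ^ 'n) set \<Rightarrow> (nat ^ 'n) set \<Rightarrow> bool" where
  "K_full K A \<longleftrightarrow> (\<exists>p\<in>poly_space A. \<forall>u\<in>K. poly_eval p u > 0)"

definition nonneg_polys :: "(nat ^ 'n) set \<Rightarrow> (real ^ 'n) set \<Rightarrow> 'n::finite mpoly set" where
  "nonneg_polys A K = {p \<in> poly_space A. \<forall>u\<in>K. poly_eval p u \<ge> 0}"

text \<open>A vector indexed by \<open>A\<close> is a function in \<open>extensional A\<close>. Integrability of the monomials is
  required explicitly because the Bochner integral of a non-integrable function is \<open>0\<close>.\<close>

definition moment_cone :: "(nat ^ 'n) set \<Rightarrow> (real ^ 'n) set \<Rightarrow> (nat ^ 'n \<Rightarrow> real) set" where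
  "moment_cone A K = {y \<in> extensional A. \<exists>\<mu> :: (real ^ 'n) measure.
     sets \<mu> = sets borel \<and> (AE x in \<mu>. x \<in> K) \<and>
     (\<forall>\<alpha>\<in>A. integrable \<mu> (monom_eval \<alpha>) \<and> y \<alpha> = integral\<^sup>L \<mu> (monom_eval \<alpha>))}"

end

theory Submission imports Defs begin

text \<open>
  For (i), pairing with a moment vector is integration against the representing measure, hence
  nonnegative on polynomials that are nonnegative on \<open>K\<close>.

  For (ii), let \<open>L\<close> be the convex cone of finite conic combinations of point evaluations on \<open>K\<close>
  and remove the \<open>a\<^sub>i\<close> one at a time. Let \<open>b\<close> be the last one and consider the values
  \<open>(f c, f b)\<close> for the \<open>f \<in> L\<close> that vanish on the others. By the induction hypothesis for
  \<open>b\<close> and \<open>- b\<close> (where the assumption on the span enters), \<open>f b\<close> takes both signs. If no such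
  \<open>f\<close> had \<open>f b = 0\<close> and \<open>f c < 0\<close>, then, \<open>L\<close> being a convex cone, every ratio \<open>f c / f b\<close> with
  \<open>f b < 0\<close> would be at most every such ratio with \<open>f b > 0\<close>. A number \<open>t\<close> in between
  satisfies \<open>f (c - t b) \<ge> 0\<close> for all such \<open>f\<close>, against the induction hypothesis for \<open>c - t b\<close>.
\<close>

section \<open>Separation for convex cones of linear functionals\<close>

lemma conic_separation:
  fixes L :: "('v::real_vector \<Rightarrow> real) set"
  assumes lin: "\<And>f. f \<in> L \<Longrightarrow> linear f"
    and add: "\<And>f g. f \<in> L \<Longrightarrow> g \<in> L \<Longrightarrow> (\<lambda>x. f x + g x) \<in> L"
    and scale: "\<And>f r. f \<in> L \<Longrightarrow> 0 \<le> r \<Longrightarrow> (\<lambda>x. r * f x) \<in> L"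
    and "finite B"
    and "\<And>p. p \<in> span B \<Longrightarrow> \<forall>f\<in>L. 0 \<le> f p \<Longrightarrow> p = 0"
    and "\<And>b. b \<in> span B \<Longrightarrow> \<exists>f\<in>L. f (c - b) < 0"
  shows "\<exists>f\<in>L. f c < 0 \<and> (\<forall>b\<in>B. f b = 0)"
  using assms(4-)
proof (induction B arbitrary: c rule: finite_induct)
  case empty
  show ?case using empty(2)[of 0] by simp
next
  case (insert b B)
  have sub: "span B \<subseteq> span (insert b B)"
    by (rule span_mono) auto
  have IH: "\<exists>f\<in>L. f d < 0 \<and> (\<forall>b\<in>B. f b = 0)"
    if "\<And>q. q \<in> span B \<Longrightarrow> \<exists>f\<in>L. f (d - q) < 0" for d
    using insert.IH[of d] insert.prems(1) sub that by blast
  have vanish: "f q = 0" if "f \<in> L" "\<forall>b\<in>B. f b = 0" "q \<in> span B" for f q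
    using linear_eq_0_on_span[OF lin[OF that(1)]] that by blast
  show ?case
  \<comment> \<open>If \<open>b\<close> depends on \<open>B\<close>, any functional vanishing on
    \<open>B\<close> vanishes at \<open>b\<close> as well.\<close>
  proof (cases "b \<in> span B")
    case True
    have "\<exists>f\<in>L. f c < 0 \<and> (\<forall>b\<in>B. f b = 0)"
      using IH insert.prems(2) sub by blast
    then show ?thesis using vanish True by auto
  next
    case False
    have in_span: "r *\<^sub>R b + q \<in> span (insert b B)" if "q \<in> span B" for r q
      using that sub by (intro span_add span_scale) (auto intro: span_base)
    \<comment> \<open>As \<open>b\<close> lies outside \<open>span B\<close>, no
      \<open>r *\<^sub>R b - q\<close> is zero, so some element of \<open>L\<close> is negative
      there. The signs of \<open>r\<close> yield \<open>fm\<close> and \<open>fp\<close>.\<close>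
    have neg: "\<exists>f\<in>L. f (r *\<^sub>R b) < 0 \<and> (\<forall>b\<in>B. f b = 0)" if "r \<noteq> 0" for r
    proof (rule IH)
      fix q assume q: "q \<in> span B"
      have "r *\<^sub>R b - q \<noteq> 0"
      proof
        assume "r *\<^sub>R b - q = 0"
        then have "(1 / r) *\<^sub>R q = b" using that by (auto simp: divide_simps)
        then show False using False span_scale[OF q, of "1 / r"] by simp
      qed
      moreover have "r *\<^sub>R b - q \<in> span (insert b B)"
        using in_span[of "- q" r] q by (simp add: span_neg)
      ultimately show "\<exists>f\<in>L. f (r *\<^sub>R b - q) < 0"
        using insert.prems(1) not_le by blast
    qed
    obtain fm where fm: "fm \<in> L" "fm b < 0" "\<forall>b\<in>B. fm b = 0"
      using neg[of 1] by auto
    obtain fp where fp: "fp \<in> L" "fp b > 0" "\<forall>b\<in>B. fp b = 0"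
      using neg[of "-1"] lin by (auto simp: linear_neg)
    show ?thesis
    proof (rule ccontr)
      assume "\<not> ?thesis"
      then have contra: "0 \<le> f c" if "f \<in> L" "\<forall>x\<in>insert b B. f x = 0" for f
        using that not_le by blast
      have cross: "f c / f b \<le> g c / g b"
        if f: "f \<in> L" "f b < 0" "\<forall>b\<in>B. f b = 0" and g: "g \<in> L" "g b > 0" "\<forall>b\<in>B. g b = 0" for f g
      proof -
        \<comment> \<open>Both coefficients are positive, so \<open>?h\<close> stays in the cone;
          they are chosen to cancel at \<open>b\<close>. Dividing \<open>?h c \<ge> 0\<close> by
          \<open>f b * g b < 0\<close> compares the ratios.\<close>
        let ?h = "\<lambda>x. g b * f x + (- f b) * g x"
        have "?h \<in> L" using f g by (intro add scale) auto
        moreover have "\<forall>x\<in>insert b B. ?h x = 0" using f g by auto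
        ultimately have "?h c \<ge> 0" by (rule contra)
        then show ?thesis using f g by (simp add: field_simps)
      qed
      define S where "S = {f c / f b | f. f \<in> L \<and> f b < 0 \<and> (\<forall>b\<in>B. f b = 0)}"
      have S: "fm c / fm b \<in> S" unfolding S_def using fm by blast
      have S_le: "s \<le> g c / g b" if "s \<in> S" "g \<in> L" "g b > 0" "\<forall>b\<in>B. g b = 0" for s g
        using that cross unfolding S_def by blast
      have bdd: "bdd_above S"
        using S_le fp by (intro bdd_aboveI[where M = "fp c / fp b"]) auto
      \<comment> \<open>\<open>fm\<close> makes \<open>S\<close> nonempty and \<open>fp\<close>
        bounds it, so the supremum separates the two families of ratios.\<close>
      define t where "t = Sup S"
      have "\<exists>f\<in>L. f (c - t *\<^sub>R b) < 0 \<and> (\<forall>b\<in>B. f b = 0)"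
      proof (rule IH)
        fix q assume "q \<in> span B"
        then show "\<exists>f\<in>L. f (c - t *\<^sub>R b - q) < 0"
          using insert.prems(2)[OF in_span, of q t] by (simp add: algebra_simps)
      qed
      then obtain f where f: "f \<in> L" "f (c - t *\<^sub>R b) < 0" "\<forall>b\<in>B. f b = 0" by blast
      have less: "f c < t * f b"
        using f(2) lin[OF f(1)] by (simp add: linear_diff linear_scale)
      \<comment> \<open>Dividing \<open>less\<close> by \<open>f b\<close> puts the ratio above
        \<open>t\<close> in the first case and below \<open>t\<close> in the last, each on the wrong
        side of the supremum.\<close>
      consider "f b < 0" | "f b = 0" | "f b > 0" by linarith
      then show False
      proof cases
        case 1
        then have "f c / f b \<in> S" unfolding S_def using f by blast
        then have "f c / f b \<le> t" unfolding t_def using bdd by (rule cSup_upper)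
        then show False using less 1 by (simp add: field_simps)
      next
        case 2
        then show False using less contra[of f] f by auto
      next
        case 3
        then have "t \<le> f c / f b"
          unfolding t_def using S S_le f by (intro cSup_least) auto
        then show False using less 3 by (simp add: field_simps)
      qed
    qed
  qed
qed

section \<open>Linearity of evaluation and pairing\<close>

text \<open>Extra indices contribute zero coefficients. A common index set is needed to compare
  \<open>p\<close>, \<open>q\<close> and \<open>p + q\<close>, whose supports differ through
  cancellation.\<close>

lemma poly_eval_eq_sum:
  assumes "finite F" "Poly_Mapping.keys p \<subseteq> F"
  shows "poly_eval p x = (\<Sum>\<alpha>\<in>F. Poly_Mapping.lookup p \<alpha> * monom_eval \<alpha> x)"
  unfolding poly_eval_def
  using assms by (intro sum.mono_neutral_left) (auto simp: in_keys_iff)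

lemma keys_scaleR_subset: "Poly_Mapping.keys (r *\<^sub>R p) \<subseteq> Poly_Mapping.keys p"
  by (auto simp: in_keys_iff scaleR_poly_mapping.rep_eq)

lemma linear_poly_eval: "linear (\<lambda>p. poly_eval p x)"
proof (rule linearI)
  fix p q :: "'a mpoly"
  let ?F = "Poly_Mapping.keys p \<union> Poly_Mapping.keys q"
  have "poly_eval (p + q) x = (\<Sum>\<alpha>\<in>?F. Poly_Mapping.lookup (p + q) \<alpha> * monom_eval \<alpha> x)"
    by (intro poly_eval_eq_sum Poly_Mapping.keys_add) auto
  also have "\<dots> = poly_eval p x + poly_eval q x"
    by (simp add: poly_eval_eq_sum[of ?F p] poly_eval_eq_sum[of ?F q]
        lookup_add distrib_right sum.distrib)
  finally show "poly_eval (p + q) x = poly_eval p x + poly_eval q x" .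
next
  fix r and p :: "'a mpoly"
  show "poly_eval (r *\<^sub>R p) x = r *\<^sub>R poly_eval p x"
    by (subst poly_eval_eq_sum[OF _ keys_scaleR_subset])
      (simp_all add: poly_eval_def scaleR_poly_mapping.rep_eq sum_distrib_left mult.assoc)
qed

lemma linear_pairing: "linear (\<lambda>p. pairing A p y)"
  by (rule linearI)
    (simp_all add: pairing_def lookup_add scaleR_poly_mapping.rep_eq distrib_right sum.distrib
      sum_distrib_left mult.assoc)

lemma keys_poly_space:
  assumes "p \<in> poly_space A"
  shows "Poly_Mapping.keys p \<subseteq> A"
  using assms unfolding poly_space_def
proof (induction rule: span_induct_alt)
  case (step r q p)
  have "Poly_Mapping.keys (r *\<^sub>R q + p) \<subseteq> Poly_Mapping.keys q \<union> Poly_Mapping.keys p"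
    using Poly_Mapping.keys_add[of "r *\<^sub>R q" p] keys_scaleR_subset[of r q] by blast
  then show ?case using step by auto
qed auto

lemma poly_eval_poly_space:
  assumes "finite A" "p \<in> poly_space A"
  shows "poly_eval p x = (\<Sum>\<alpha>\<in>A. Poly_Mapping.lookup p \<alpha> * monom_eval \<alpha> x)"
  using assms by (intro poly_eval_eq_sum keys_poly_space)

section \<open>Moment vectors and their representing measures\<close>

lemma pairing_moment_cone_nonneg:
  assumes "finite A" "y \<in> moment_cone A K" "p \<in> nonneg_polys A K"
  shows "0 \<le> pairing A p y"
proof -
  obtain \<mu> :: "(real ^ 'a) measure" where \<mu>: "AE x in \<mu>. x \<in> K"
    "\<And>\<alpha>. \<alpha> \<in> A \<Longrightarrow> integrable \<mu> (monom_eval \<alpha>)"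
    "\<And>\<alpha>. \<alpha> \<in> A \<Longrightarrow> y \<alpha> = integral\<^sup>L \<mu> (monom_eval \<alpha>)"
    using assms(2) unfolding moment_cone_def by blast
  have p: "p \<in> poly_space A" "\<And>u. u \<in> K \<Longrightarrow> 0 \<le> poly_eval p u"
    using assms(3) unfolding nonneg_polys_def by auto
  have "pairing A p y = (\<Sum>\<alpha>\<in>A. \<integral>x. Poly_Mapping.lookup p \<alpha> * monom_eval \<alpha> x \<partial>\<mu>)"
    using \<mu> unfolding pairing_def by (intro sum.cong) auto
  \<comment> \<open>Integrability of each monomial permits exchanging the finite sum with the
    integral.\<close>
  also have "\<dots> = (\<integral>x. poly_eval p x \<partial>\<mu>)"
    using \<mu> by (simp add: poly_eval_poly_space[OF assms(1) p(1)] Bochner_Integration.integral_sum)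
  also have "\<dots> \<ge> 0"
    using \<mu>(1) p(2) by (intro integral_nonneg_AE) auto
  finally show ?thesis .
qed

lemma atomic_in_moment_cone:
  fixes K :: "(real ^ 'n) set"
  assumes "finite S" "S \<subseteq> K" "\<And>u. 0 \<le> w u"
  shows "(\<lambda>\<alpha>\<in>A. \<Sum>u\<in>S. w u * monom_eval \<alpha> u) \<in> moment_cone A K"
proof -
  \<comment> \<open>\<open>M\<close> lives on the finite space \<open>S\<close> with all subsets
    measurable; its image under the inclusion is the Borel measure with mass \<open>w u\<close> at
    each \<open>u\<close> in \<open>S\<close>.\<close>
  define M where "M = point_measure S (\<lambda>u. ennreal (w u))"
  define \<mu> :: "(real ^ 'n) measure" where "\<mu> = distr M borel (\<lambda>x. x)"
  have meas: "(\<lambda>x. x) \<in> M \<rightarrow>\<^sub>M borel"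
    by (simp add: M_def point_measure_def)
  have mono: "monom_eval \<alpha> \<in> borel_measurable borel" for \<alpha> :: "nat ^ 'n"
    unfolding monom_eval_def by (intro borel_measurable_continuous_onI continuous_intros)
  have K: "AE x in \<mu>. x \<in> K"
  proof -
    \<comment> \<open>A finite set is closed, hence Borel, so the claim can be pulled back to
      \<open>M\<close>.\<close>
    have "AE x in \<mu>. x \<in> S"
      unfolding \<mu>_def using assms(1) finite_imp_closed[of S]
      by (subst AE_distr_iff[OF meas]) (auto simp: M_def space_point_measure intro!: AE_I2)
    then show ?thesis by eventually_elim (use assms(2) in auto)
  qed
  have "integrable \<mu> (monom_eval \<alpha>)" for \<alpha>
    unfolding \<mu>_def by (subst integrable_distr_eq[OF meas mono])
      (simp add: M_def integrable_point_measure_finite assms)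
  moreover have "integral\<^sup>L \<mu> (monom_eval \<alpha>) = (\<Sum>u\<in>S. w u * monom_eval \<alpha> u)" for \<alpha>
    unfolding \<mu>_def by (subst integral_distr[OF meas mono])
      (simp add: M_def lebesgue_integral_point_measure_finite assms)
  moreover have "sets \<mu> = sets borel" by (simp add: \<mu>_def)
  ultimately show ?thesis using K unfolding moment_cone_def by auto
qed

text \<open>Turns an element of the span into multipliers \<open>l\<close> of (D). Coefficients are
  indexed by \<open>I\<close> rather than by the image, so repeated vectors are allowed.\<close>

lemma span_image_finite:
  fixes a :: "'i \<Rightarrow> 'v::real_vector"
  assumes "finite I" "p \<in> span (a ` I)"
  shows "\<exists>l. p = (\<Sum>i\<in>I. l i *\<^sub>R a i)"
  using assms
proof (induction I arbitrary: p rule: finite_induct)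
  case (insert j I)
  then obtain k where "p - k *\<^sub>R a j \<in> span (a ` I)"
    by (auto simp: span_insert)
  with insert.IH obtain l where l: "p - k *\<^sub>R a j = (\<Sum>i\<in>I. l i *\<^sub>R a i)" by blast
  \<comment> \<open>Since \<open>j\<close> is not in \<open>I\<close>, the update leaves the sum
    over \<open>I\<close> unchanged.\<close>
  have "p = (\<Sum>i\<in>insert j I. (l(j := k)) i *\<^sub>R a i)"
    using insert.hyps l by (auto simp: algebra_simps intro!: sum.cong)
  then show ?case by blast
qed simp

section \<open>The cone generated by point evaluations\<close>

text \<open>The cone \<open>L\<close> of the overview: integration against finitely supported
  measures on \<open>K\<close>. Taken as functionals, they form a cone under pointwise
  operations.\<close>

definition atomic_functionals :: "(real ^ 'n) set \<Rightarrow> ('n::finite mpoly \<Rightarrow> real) set" where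
  "atomic_functionals K =
    {\<lambda>p. \<Sum>u\<in>S. w u * poly_eval p u | S w. finite S \<and> S \<subseteq> K \<and> (\<forall>u. 0 \<le> w u)}"

lemma atomic_functionalsI:
  assumes "finite S" "S \<subseteq> K" "\<And>u. 0 \<le> w u" "\<And>p. f p = (\<Sum>u\<in>S. w u * poly_eval p u)"
  shows "f \<in> atomic_functionals K"
  unfolding atomic_functionals_def
  using assms by (intro CollectI exI[of _ S] exI[of _ w]) auto

lemma linear_atomic_functional: "f \<in> atomic_functionals K \<Longrightarrow> linear f"
  unfolding atomic_functionals_def
  by (auto intro!: linear_compose_sum linear_compose_scale_right[where 'b = real, simplified]
      linear_poly_eval)

lemma atomic_functionals_add:
  assumes "f \<in> atomic_functionals K" "g \<in> atomic_functionals K"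
  shows "(\<lambda>p. f p + g p) \<in> atomic_functionals K"
proof -
  obtain S v where f: "f = (\<lambda>p. \<Sum>u\<in>S. v u * poly_eval p u)" "finite S" "S \<subseteq> K" "\<forall>u. 0 \<le> v u"
    using assms(1) unfolding atomic_functionals_def by blast
  obtain T w where g: "g = (\<lambda>p. \<Sum>u\<in>T. w u * poly_eval p u)" "finite T" "T \<subseteq> K" "\<forall>u. 0 \<le> w u"
    using assms(2) unfolding atomic_functionals_def by blast
  \<comment> \<open>Each weight is extended by zero outside its own support, so that weights add
    where \<open>S\<close> and \<open>T\<close> overlap.\<close>
  let ?v = "\<lambda>u. (if u \<in> S then v u else 0) + (if u \<in> T then w u else 0)"
  have "f p = (\<Sum>u\<in>S \<union> T. (if u \<in> S then v u else 0) * poly_eval p u)" for p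
    unfolding f(1) using f g by (intro sum.mono_neutral_cong_left) auto
  moreover have "g p = (\<Sum>u\<in>S \<union> T. (if u \<in> T then w u else 0) * poly_eval p u)" for p
    unfolding g(1) using f g by (intro sum.mono_neutral_cong_left) auto
  ultimately have "f p + g p = (\<Sum>u\<in>S \<union> T. ?v u * poly_eval p u)" for p
    by (simp only: distrib_right sum.distrib)
  then show ?thesis
    using f g by (intro atomic_functionalsI[where S = "S \<union> T" and w = ?v]) auto
qed

lemma atomic_functionals_scale:
  assumes "f \<in> atomic_functionals K" "0 \<le> r"
  shows "(\<lambda>p. r * f p) \<in> atomic_functionals K"
proof -
  obtain S v where f: "f = (\<lambda>p. \<Sum>u\<in>S. v u * poly_eval p u)" "finite S" "S \<subseteq> K" "\<forall>u. 0 \<le> v u"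
    using assms(1) unfolding atomic_functionals_def by blast
  then show ?thesis
    using assms(2) by (intro atomic_functionalsI[where S = S and w = "\<lambda>u. r * v u"])
      (simp_all add: sum_distrib_left mult.assoc)
qed

lemma poly_eval_in_atomic_functionals:
  assumes "u \<in> K"
  shows "(\<lambda>p. poly_eval p u) \<in> atomic_functionals K"
  using assms by (intro atomic_functionalsI[where S = "{u}" and w = "\<lambda>_. 1"]) auto

text \<open>Returns from functionals to moment vectors: \<open>y\<close> lists the moments of the
  atomic measure. Only polynomials supported in \<open>A\<close> are covered, because the pairing
  ignores other coefficients.\<close>

lemma atomic_functional_eq_pairing:
  assumes "finite A" "f \<in> atomic_functionals K"
  shows "\<exists>y\<in>moment_cone A K. \<forall>p\<in>poly_space A. f p = pairing A p y"
proof -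
  obtain S w where f: "f = (\<lambda>p. \<Sum>u\<in>S. w u * poly_eval p u)" "finite S" "S \<subseteq> K" "\<forall>u. 0 \<le> w u"
    using assms(2) unfolding atomic_functionals_def by blast
  let ?y = "\<lambda>\<alpha>\<in>A. \<Sum>u\<in>S. w u * monom_eval \<alpha> u"
  have "f p = pairing A p ?y" if p: "p \<in> poly_space A" for p
  proof -
    have "f p = (\<Sum>u\<in>S. \<Sum>\<alpha>\<in>A. Poly_Mapping.lookup p \<alpha> * (w u * monom_eval \<alpha> u))"
      by (simp add: f(1) poly_eval_poly_space[OF assms(1) p] sum_distrib_left mult.left_commute)
    also have "\<dots> = pairing A p ?y"
      by (subst sum.swap) (simp add: pairing_def sum_distrib_left)
    finally show ?thesis .
  qed
  moreover have "?y \<in> moment_cone A K" using f by (intro atomic_in_moment_cone) auto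
  ultimately show ?thesis by blast
qed

section \<open>Moment vectors as certificates of infeasibility\<close>

theorem lemma5p5:
  fixes K :: "(real ^ 'n) set"
    and A :: "(nat ^ 'n) set"
    and c :: "'n mpoly"
    and a :: "nat \<Rightarrow> 'n mpoly"
    and m :: nat
  assumes "compact K"
    and "finite A"
    and "K_full K A"
    and "c \<in> poly_space A"
    and "\<forall>i\<in>{1..m}. a i \<in> poly_space A"
  shows
    "((\<exists>y\<in>moment_cone A K. pairing A c y < 0 \<and> (\<forall>i\<in>{1..m}. pairing A (a i) y = 0)) \<longrightarrow>
        \<not> (\<exists>l :: nat \<Rightarrow> real. c - (\<Sum>i=1..m. l i *\<^sub>R a i) \<in> nonneg_polys A K))
     \<and>
     (\<not> (\<exists>p\<in>span (a ` {1..m}). p \<noteq> 0 \<and> (\<forall>u\<in>K. poly_eval p u \<ge> 0)) \<longrightarrow>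
      \<not> (\<exists>l :: nat \<Rightarrow> real. c - (\<Sum>i=1..m. l i *\<^sub>R a i) \<in> nonneg_polys A K) \<longrightarrow>
        (\<exists>y\<in>moment_cone A K. pairing A c y < 0 \<and> (\<forall>i\<in>{1..m}. pairing A (a i) y = 0)))"
proof (intro conjI impI)
  assume "\<exists>y\<in>moment_cone A K. pairing A c y < 0 \<and> (\<forall>i\<in>{1..m}. pairing A (a i) y = 0)"
  then obtain y where y: "y \<in> moment_cone A K" "pairing A c y < 0"
    "\<And>i. i \<in> {1..m} \<Longrightarrow> pairing A (a i) y = 0" by blast
  \<comment> \<open>The pairing stays at the same negative value for all multipliers, whereas a
    feasible one would make it nonnegative.\<close>
  have "pairing A (c - (\<Sum>i=1..m. l i *\<^sub>R a i)) y = pairing A c y" for l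
    using y(3) by (simp add: linear_diff[OF linear_pairing] linear_sum[OF linear_pairing]
        linear_scale[OF linear_pairing])
  then show "\<not> (\<exists>l. c - (\<Sum>i=1..m. l i *\<^sub>R a i) \<in> nonneg_polys A K)"
    using pairing_moment_cone_nonneg[OF assms(2) y(1)] y(2) by (metis not_le)
next
  assume span: "\<not> (\<exists>p\<in>span (a ` {1..m}). p \<noteq> 0 \<and> (\<forall>u\<in>K. poly_eval p u \<ge> 0))"
    and infeasible: "\<not> (\<exists>l. c - (\<Sum>i=1..m. l i *\<^sub>R a i) \<in> nonneg_polys A K)"
  let ?L = "atomic_functionals K"
  have "\<exists>f\<in>?L. f c < 0 \<and> (\<forall>b\<in>a ` {1..m}. f b = 0)"
  proof (rule conic_separation)
    fix p assume p: "p \<in> span (a ` {1..m})" "\<forall>f\<in>?L. 0 \<le> f p"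
    \<comment> \<open>Point evaluations belong to the cone, so nonnegativity under the cone is
      nonnegativity on \<open>K\<close>.\<close>
    have "0 \<le> poly_eval p u" if "u \<in> K" for u
      using bspec[OF p(2) poly_eval_in_atomic_functionals[OF that]] .
    then show "p = 0" using span p(1) by blast
  next
    fix b assume "b \<in> span (a ` {1..m})"
    then obtain l where b: "b = (\<Sum>i=1..m. l i *\<^sub>R a i)"
      using span_image_finite[of "{1..m}"] by blast
    \<comment> \<open>Membership in the space leaves a negative value at some \<open>u\<close> in
      \<open>K\<close> as the only cause of infeasibility; evaluation at \<open>u\<close> is the
      required functional.\<close>
    have "c - b \<in> poly_space A"
      using assms(4,5) unfolding b poly_space_def
      by (intro span_diff span_sum span_scale) auto
    moreover have "c - b \<notin> nonneg_polys A K" using infeasible b by blast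
    ultimately obtain u where "u \<in> K" "poly_eval (c - b) u < 0"
      unfolding nonneg_polys_def by (auto simp: not_le)
    then show "\<exists>f\<in>?L. f (c - b) < 0"
      by (intro bexI[OF _ poly_eval_in_atomic_functionals])
  qed (erule linear_atomic_functional, erule (1) atomic_functionals_add,
      erule (1) atomic_functionals_scale, simp)
  then obtain f where f: "f \<in> ?L" "f c < 0" "\<And>i. i \<in> {1..m} \<Longrightarrow> f (a i) = 0" by blast
  obtain y where "y \<in> moment_cone A K" "\<forall>p\<in>poly_space A. f p = pairing A p y"
    using atomic_functional_eq_pairing[OF assms(2) f(1)] by blast
  then show "\<exists>y\<in>moment_cone A K. pairing A c y < 0 \<and> (\<forall>i\<in>{1..m}. pairing A (a i) y = 0)"
    using f assms(4,5) by (intro bexI[of _ y]) auto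
qed

end
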